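(* Let $n\ge3$ and let $(x_1,y_1),\dots,(x_n,y_n)\in\mathbb{R}^2$ be observations. Then the estimators $\tilde\kappa$, $\hat\kappa$ and $\kappa^*$ computed from these observations satisfy $$\tilde\kappa=\kappa^*+\frac14\left[\frac{-2n}{(n-1)^2}U_{12n}+\frac{2}{(n-1)^2}U_{3n}+\frac{2}{n-1}U_{1n}U_{2n}\right],$$ $$\hat\kappa=\kappa^*+\frac14\left[\frac{2-3n}{n^2}U_{12n}-2\Big(\frac{2-3n}{n^2}\Big)U_{3n}+\Big(\frac{1-2n}{n^2}\Big)U_{1n}U_{2n}\right].$$
   Context: Define $A_{1}(x_i)=\frac1n\sum_{k=1}^n|x_i-x_k|$, $A_{2}(y_i)=\frac1n\sum_{k=1}^n|y_i-y_k|$, $B_1=\frac1n\sum_{i=1}^nA_1(x_i)$, $B_2=\frac1n\sum_{i=1}^nA_2(y_i)$. V-type estimator: $h_{\hat F_1}(x_i,x_j)=-\frac12\big(|x_i-x_j|-A_1(x_i)-A_1(x_j)+B_1\big)$, $h_{\hat F_2}(y_i,y_j)=-\frac12\big(|y_i-y_j|-A_2(y_i)-A_2(y_j)+B_2\big)$, and $$\hat\kappa=\frac1{n^2}\sum_{i,j=1}^n h_{\hat F_1}(x_i,x_j)h_{\hat F_2}(y_i,y_j).$$ U-type estimator: $\tilde h_{\hat F_1}(x_i,x_j)=-\frac12\big(|x_i-x_j|-\frac{n}{n-1}A_1(x_i)-\frac{n}{n-1}A_1(x_j)+\frac{n}{n-1}B_1\big)$, $\tilde h_{\hat F_2}(y_i,y_j)=-\frac12\big(|y_i-y_j|-\frac{n}{n-1}A_2(y_i)-\frac{n}{n-1}A_2(y_j)+\frac{n}{n-1}B_2\big)$,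 and $$\tilde\kappa=\binom n2^{-1}\sum_{1\le i<j\le n}\tilde h_{\hat F_1}(x_i,x_j)\tilde h_{\hat F_2}(y_i,y_j).$$ U-statistics: $U_{1n}=\binom n2^{-1}\sum_{i<j}|x_i-x_j|$, $U_{2n}=\binom n2^{-1}\sum_{i<j}|y_i-y_j|$, $U_{12n}=\binom n2^{-1}\sum_{i<j}|x_i-x_j|\,|y_i-y_j|$, and $U_{3n}=\binom n3^{-1}\sum_{i<j<k}h\big((x_i,y_i),(x_j,y_j),(x_k,y_k)\big)$, where $h$ is the symmetrization of $|x_1-x_2|\,|y_1-y_3|$: $$h\big((x_1,y_1),(x_2,y_2),(x_3,y_3)\big)=\tfrac16\big[|x_1-x_2||y_1-y_3|+|x_2-x_1||y_2-y_3|+|x_1-x_3||y_1-y_2|+|x_2-x_3||y_2-y_1|+|x_3-x_1||y_3-y_2|+|x_3-x_2||y_3-y_1|\big].$$ Finally, $\kappa^*=\frac14\big[U_{12n}+U_{1n}U_{2n}-2U_{3n}\big]$. *)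

theory Defs
  imports Complex_Main
begin

text \<open>
  A sample \<open>z\<^sub>1, \<dots>, z\<^sub>n\<close> is a function \<open>z :: nat \<Rightarrow> real\<close> of which only the values at
  \<open>1, \<dots>, n\<close> are used. The marginal quantities with index 1 and 2 have the same
  definition and are obtained by applying it to \<open>x\<close> and to \<open>y\<close>, respectively.
\<close>

definition A_mean :: "nat \<Rightarrow> (nat \<Rightarrow> real) \<Rightarrow> nat \<Rightarrow> real" where
  "A_mean n z i = 1 / real n * (\<Sum>k = 1..n. \<bar>z i - z k\<bar>)"

definition B_mean :: "nat \<Rightarrow> (nat \<Rightarrow> real) \<Rightarrow> real" where
  "B_mean n z = 1 / real n * (\<Sum>i = 1..n. A_mean n z i)"

definition h_hat :: "nat \<Rightarrow> (nat \<Rightarrow> real) \<Rightarrow> nat \<Rightarrow> nat \<Rightarrow> real" where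
  "h_hat n z i j =
     - (1 / 2) * (\<bar>z i - z j\<bar> - A_mean n z i - A_mean n z j + B_mean n z)"

definition h_tilde :: "nat \<Rightarrow> (nat \<Rightarrow> real) \<Rightarrow> nat \<Rightarrow> nat \<Rightarrow> real" where
  "h_tilde n z i j =
     - (1 / 2) * (\<bar>z i - z j\<bar>
        - real n / (real n - 1) * A_mean n z i
        - real n / (real n - 1) * A_mean n z j
        + real n / (real n - 1) * B_mean n z)"

definition index_pairs :: "nat \<Rightarrow> (nat \<times> nat) set" where
  "index_pairs n = {(i, j). 1 \<le> i \<and> i < j \<and> j \<le> n}"

definition index_triples :: "nat \<Rightarrow> (nat \<times> nat \<times> nat) set" where
  "index_triples n = {(i, j, k). 1 \<le> i \<and> i < j \<and> j < k \<and> k \<le> n}"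

definition kappa_hat :: "nat \<Rightarrow> (nat \<Rightarrow> real) \<Rightarrow> (nat \<Rightarrow> real) \<Rightarrow> real" where
  "kappa_hat n x y =
     1 / (real n)\<^sup>2 * (\<Sum>i = 1..n. \<Sum>j = 1..n. h_hat n x i j * h_hat n y i j)"

definition kappa_tilde :: "nat \<Rightarrow> (nat \<Rightarrow> real) \<Rightarrow> (nat \<Rightarrow> real) \<Rightarrow> real" where
  "kappa_tilde n x y =
     inverse (real (n choose 2)) *
     (\<Sum>(i, j) \<in> index_pairs n. h_tilde n x i j * h_tilde n y i j)"

definition U_dist :: "nat \<Rightarrow> (nat \<Rightarrow> real) \<Rightarrow> real" where
  "U_dist n z =
     inverse (real (n choose 2)) * (\<Sum>(i, j) \<in> index_pairs n. \<bar>z i - z j\<bar>)"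

definition U12 :: "nat \<Rightarrow> (nat \<Rightarrow> real) \<Rightarrow> (nat \<Rightarrow> real) \<Rightarrow> real" where
  "U12 n x y =
     inverse (real (n choose 2)) *
     (\<Sum>(i, j) \<in> index_pairs n. \<bar>x i - x j\<bar> * \<bar>y i - y j\<bar>)"

fun h_sym :: "real \<times> real \<Rightarrow> real \<times> real \<Rightarrow> real \<times> real \<Rightarrow> real" where
  "h_sym (x1, y1) (x2, y2) (x3, y3) =
     1 / 6 * (\<bar>x1 - x2\<bar> * \<bar>y1 - y3\<bar> + \<bar>x2 - x1\<bar> * \<bar>y2 - y3\<bar>
            + \<bar>x1 - x3\<bar> * \<bar>y1 - y2\<bar> + \<bar>x2 - x3\<bar> * \<bar>y2 - y1\<bar>
            + \<bar>x3 - x1\<bar> * \<bar>y3 - y2\<bar> + \<bar>x3 - x2\<bar> * \<bar>y3 - y1\<bar>)"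

definition U3 :: "nat \<Rightarrow> (nat \<Rightarrow> real) \<Rightarrow> (nat \<Rightarrow> real) \<Rightarrow> real" where
  "U3 n x y =
     inverse (real (n choose 3)) *
     (\<Sum>(i, j, k) \<in> index_triples n. h_sym (x i, y i) (x j, y j) (x k, y k))"

definition kappa_star :: "nat \<Rightarrow> (nat \<Rightarrow> real) \<Rightarrow> (nat \<Rightarrow> real) \<Rightarrow> real" where
  "kappa_star n x y = 1 / 4 * (U12 n x y + U_dist n x * U_dist n y - 2 * U3 n x y)"

end

theory Submission
  imports Defs
begin

text \<open>
  Write \<open>a\<^sub>i\<^sub>j = \<bar>x\<^sub>i - x\<^sub>j\<bar>\<close> and \<open>b\<^sub>i\<^sub>j = \<bar>y\<^sub>i - y\<^sub>j\<bar>\<close>, symmetric matrices with zero diagonal.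
  Every statistic in the theorem is a function of only four full sums over \<open>{1..n}\<close>: the inner
  product \<open>P = \<Sum>\<^sub>i\<^sub>j a\<^sub>i\<^sub>j b\<^sub>i\<^sub>j\<close>, the inner product \<open>R = \<Sum>\<^sub>i a\<^sub>i\<^sub>\<cdot> b\<^sub>i\<^sub>\<cdot>\<close> of the row sums, and the two
  totals \<open>S = \<Sum>\<^sub>i\<^sub>j a\<^sub>i\<^sub>j\<close> and \<open>T = \<Sum>\<^sub>i\<^sub>j b\<^sub>i\<^sub>j\<close>.

  For the U-statistics this is symmetrization: a sum over increasing index tuples is the sum over
  tuples of distinct indices, divided by the number of orderings, and the zero diagonals make
  the tuples with coincidences harmless. This gives \<open>U\<^sub>1\<^sub>2 = P / (n (n - 1))\<close>,
  \<open>U\<^sub>1 = S / (n (n - 1))\<close>, \<open>U\<^sub>2 = T / (n (n - 1))\<close> and \<open>U\<^sub>3 = (R - P) / (n (n - 1) (n - 2))\<close>; in \<open>R\<close> the only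
  surviving coincidence is \<open>j = k\<close> in \<open>a\<^sub>i\<^sub>j b\<^sub>i\<^sub>k\<close>, and it contributes \<open>P\<close>.

  Both \<open>h_hat\<close> and \<open>h_tilde\<close> have the shape
  \<open>-1/2 (a\<^sub>i\<^sub>j - s (a\<^sub>i\<^sub>\<cdot> + a\<^sub>j\<^sub>\<cdot>) + t)\<close>: the first with \<open>s = 1 / n\<close>, \<open>t = S / n\<^sup>2\<close>, the
  second with \<open>s = 1 / (n - 1)\<close>, \<open>t = S / (n (n - 1))\<close>. The sum of products of two such centred
  matrices is expanded once, for general \<open>s\<close> and \<open>t\<close> (\<open>sum_centred_product\<close>); for \<open>kappa_tilde\<close>
  the diagonal, on which the centred matrices do not vanish, has to be subtracted. The theorem is
  then an identity between rational functions of \<open>n\<close> that is linear in \<open>P\<close>, \<open>R\<close> and \<open>S T\<close>.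
\<close>

section \<open>Sums over increasing index tuples\<close>

lemma sum_index_pairs_conditional:
  fixes f :: "nat \<Rightarrow> nat \<Rightarrow> real"
  shows "(\<Sum>(i, j) \<in> index_pairs n. f i j) =
         (\<Sum>i = 1..n. \<Sum>j = 1..n. if i < j then f i j else 0)"
proof -
  have "(\<Sum>(i, j) \<in> index_pairs n. f i j) =
        (\<Sum>(i, j) \<in> {1..n} \<times> {1..n}. if i < j then f i j else 0)"
    by (rule sum.mono_neutral_cong_left) (auto simp: index_pairs_def split: if_splits)
  then show ?thesis
    by (simp add: sum.cartesian_product)
qed

lemma sum_index_triples_conditional:
  fixes f :: "nat \<Rightarrow> nat \<Rightarrow> nat \<Rightarrow> real"
  shows "(\<Sum>(i, j, k) \<in> index_triples n. f i j k) =
         (\<Sum>i = 1..n. \<Sum>j = 1..n. \<Sum>k = 1..n. if i < j \<and> j < k then f i j k else 0)"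
proof -
  have "(\<Sum>(i, j, k) \<in> index_triples n. f i j k) =
        (\<Sum>(i, j, k) \<in> {1..n} \<times> {1..n} \<times> {1..n}. if i < j \<and> j < k then f i j k else 0)"
    by (rule sum.mono_neutral_cong_left) (auto simp: index_triples_def split: if_splits)
  then show ?thesis
    by (simp add: sum.cartesian_product)
qed

lemma two_sum_index_pairs:
  fixes f :: "nat \<Rightarrow> nat \<Rightarrow> real"
  assumes sym: "\<And>i j. f i j = f j i"
  shows "2 * (\<Sum>(i, j) \<in> index_pairs n. f i j) =
         (\<Sum>i = 1..n. \<Sum>j = 1..n. f i j) - (\<Sum>i = 1..n. f i i)"
proof -
  let ?I = "{1..n}"
  have flip: "(\<Sum>i\<in>?I. \<Sum>j\<in>?I. if i < j then f i j else 0) =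
              (\<Sum>i\<in>?I. \<Sum>j\<in>?I. if j < i then f i j else 0)"
    by (subst sum.swap) (simp add: sym cong: if_cong)
  have diag: "(\<Sum>i\<in>?I. f i i) = (\<Sum>i\<in>?I. \<Sum>j\<in>?I. if i = j then f i j else 0)"
    by (intro sum.cong) auto
  have "(\<Sum>i\<in>?I. \<Sum>j\<in>?I. f i j) =
        (\<Sum>i\<in>?I. \<Sum>j\<in>?I. (if i < j then f i j else 0) + (if j < i then f i j else 0)
           + (if i = j then f i j else 0))"
    by (intro sum.cong refl) auto
  then show ?thesis
    using flip unfolding sum_index_pairs_conditional diag
    by (simp add: sum.distrib)
qed

text \<open>
  Each of the six terms is, after permuting the summation indices, the sum of \<open>f i j k\<close> over one of
  the six possible orderings of three distinct indices.
\<close>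
lemma sum_index_triples_symmetrized:
  fixes f :: "nat \<Rightarrow> nat \<Rightarrow> nat \<Rightarrow> real"
  shows "(\<Sum>(i, j, k) \<in> index_triples n.
            f i j k + f j i k + f i k j + f j k i + f k i j + f k j i) =
         (\<Sum>i = 1..n. \<Sum>j = 1..n. \<Sum>k = 1..n.
            if i \<noteq> j \<and> i \<noteq> k \<and> j \<noteq> k then f i j k else 0)"
proof -
  define tsum where "tsum g = (\<Sum>i = 1..n. \<Sum>j = 1..n. \<Sum>k = 1..n. g i j k)"
    for g :: "nat \<Rightarrow> nat \<Rightarrow> nat \<Rightarrow> real"
  have swap12: "tsum g = tsum (\<lambda>i j k. g j i k)" for g
    unfolding tsum_def by (rule sum.swap)
  have swap23: "tsum g = tsum (\<lambda>i j k. g i k j)" for g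
    unfolding tsum_def by (intro sum.cong refl sum.swap)
  let ?o = "\<lambda>i j k :: nat. i < j \<and> j < k"
  have 2: "tsum (\<lambda>i j k. if ?o i j k then f j i k else 0) = tsum (\<lambda>i j k. if ?o j i k then f i j k else 0)"
    by (rule swap12)
  have 3: "tsum (\<lambda>i j k. if ?o i j k then f i k j else 0) = tsum (\<lambda>i j k. if ?o i k j then f i j k else 0)"
    by (rule swap23)
  have 4: "tsum (\<lambda>i j k. if ?o i j k then f j k i else 0) = tsum (\<lambda>i j k. if ?o k i j then f i j k else 0)"
    by (rule trans[OF swap12 swap23])
  have 5: "tsum (\<lambda>i j k. if ?o i j k then f k i j else 0) = tsum (\<lambda>i j k. if ?o j k i then f i j k else 0)"
    by (rule trans[OF swap23 swap12])
  have 6: "tsum (\<lambda>i j k. if ?o i j k then f k j i else 0) = tsum (\<lambda>i j k. if ?o k j i then f i j k else 0)"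
    by (rule trans[OF swap12 trans[OF swap23 swap12]])
  have add: "tsum g + tsum h = tsum (\<lambda>i j k. g i j k + h i j k)" for g h
    unfolding tsum_def by (simp add: sum.distrib)
  have "(\<Sum>(i, j, k) \<in> index_triples n.
            f i j k + f j i k + f i k j + f j k i + f k i j + f k j i) =
        tsum (\<lambda>i j k. if ?o i j k then f i j k else 0)
      + tsum (\<lambda>i j k. if ?o i j k then f j i k else 0)
      + tsum (\<lambda>i j k. if ?o i j k then f i k j else 0)
      + tsum (\<lambda>i j k. if ?o i j k then f j k i else 0)
      + tsum (\<lambda>i j k. if ?o i j k then f k i j else 0)
      + tsum (\<lambda>i j k. if ?o i j k then f k j i else 0)"
    unfolding sum_index_triples_conditional add unfolding tsum_def
    by (intro sum.cong refl) auto
  also have "\<dots> = tsum (\<lambda>i j k. if i \<noteq> j \<and> i \<noteq> k \<and> j \<noteq> k then f i j k else 0)"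
    unfolding 2 3 4 5 6 add unfolding tsum_def
    by (intro sum.cong refl) auto
  finally show ?thesis
    unfolding tsum_def .
qed

lemma real_choose_two: "real (n choose 2) = real n * (real n - 1) / 2"
  by (simp add: binomial_gbinomial gbinomial_prod_rev numeral_2_eq_2)

lemma real_choose_three: "real (n choose 3) = real n * (real n - 1) * (real n - 2) / 6"
  by (simp add: binomial_gbinomial gbinomial_prod_rev numeral_3_eq_3 field_simps)

text \<open>
  The pair statistics, including \<open>kappa_tilde\<close>, all normalize by the binomial coefficient, which
  absorbs the factor 2 from the two orderings of a pair.
\<close>
lemma pair_average:
  fixes f :: "nat \<Rightarrow> nat \<Rightarrow> real"
  assumes "\<And>i j. f i j = f j i"
  shows "inverse (real (n choose 2)) * (\<Sum>(i, j) \<in> index_pairs n. f i j) =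
         ((\<Sum>i = 1..n. \<Sum>j = 1..n. f i j) - (\<Sum>i = 1..n. f i i)) / (real n * (real n - 1))"
  using two_sum_index_pairs[of f n, OF assms] by (simp add: real_choose_two divide_simps)

section \<open>The U-statistics as full sums\<close>

definition row_sum :: "nat \<Rightarrow> (nat \<Rightarrow> real) \<Rightarrow> nat \<Rightarrow> real" where
  "row_sum n z i = (\<Sum>j = 1..n. \<bar>z i - z j\<bar>)"

definition total :: "nat \<Rightarrow> (nat \<Rightarrow> real) \<Rightarrow> real" where
  "total n z = (\<Sum>i = 1..n. row_sum n z i)"

definition entry_product :: "nat \<Rightarrow> (nat \<Rightarrow> real) \<Rightarrow> (nat \<Rightarrow> real) \<Rightarrow> real" where
  "entry_product n x y = (\<Sum>i = 1..n. \<Sum>j = 1..n. \<bar>x i - x j\<bar> * \<bar>y i - y j\<bar>)"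

definition row_product :: "nat \<Rightarrow> (nat \<Rightarrow> real) \<Rightarrow> (nat \<Rightarrow> real) \<Rightarrow> real" where
  "row_product n x y = (\<Sum>i = 1..n. row_sum n x i * row_sum n y i)"

lemma U_dist_eq: "U_dist n z = total n z / (real n * (real n - 1))"
  unfolding U_dist_def
  by (subst pair_average) (simp_all add: total_def row_sum_def abs_minus_commute)

lemma U12_eq: "U12 n x y = entry_product n x y / (real n * (real n - 1))"
  unfolding U12_def
  by (subst pair_average) (simp_all add: entry_product_def abs_minus_commute)

text \<open>
  Among the triples with a coincidence, \<open>i = j\<close> and \<open>i = k\<close> hit a zero diagonal entry of one of the
  two distance matrices, so only \<open>j = k\<close> has to be removed from the unrestricted sum.
\<close>
lemma sum_distinct_triples:
  "(\<Sum>i = 1..n. \<Sum>j = 1..n. \<Sum>k = 1..n.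
      if i \<noteq> j \<and> i \<noteq> k \<and> j \<noteq> k then \<bar>x i - x j\<bar> * \<bar>y i - y k\<bar> else 0) =
   row_product n x y - entry_product n x y"
proof -
  let ?f = "\<lambda>i j k. \<bar>x i - x j\<bar> * \<bar>y i - y k\<bar>"
  have "(\<Sum>k = 1..n. if i \<noteq> j \<and> i \<noteq> k \<and> j \<noteq> k then ?f i j k else 0) =
        (\<Sum>k = 1..n. ?f i j k) - ?f i j j" if "j \<in> {1..n}" for i j
  proof -
    have "(\<Sum>k = 1..n. if i \<noteq> j \<and> i \<noteq> k \<and> j \<noteq> k then ?f i j k else 0) =
          (\<Sum>k = 1..n. ?f i j k - (if j = k then ?f i j k else 0))"
      by (intro sum.cong refl) auto
    also have "\<dots> = (\<Sum>k = 1..n. ?f i j k) - ?f i j j"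
      using that by (simp add: sum_subtractf)
    finally show ?thesis .
  qed
  then show ?thesis
    by (simp add: sum_subtractf row_product_def entry_product_def row_sum_def sum_product)
qed

lemma U3_eq:
  "U3 n x y =
   (row_product n x y - entry_product n x y) / (real n * (real n - 1) * (real n - 2))"
proof -
  let ?f = "\<lambda>i j k. \<bar>x i - x j\<bar> * \<bar>y i - y k\<bar>"
  have "(\<Sum>(i, j, k) \<in> index_triples n. h_sym (x i, y i) (x j, y j) (x k, y k)) =
        1 / 6 * (\<Sum>(i, j, k) \<in> index_triples n.
          ?f i j k + ?f j i k + ?f i k j + ?f j k i + ?f k i j + ?f k j i)"
    unfolding sum_distrib_left by (intro sum.cong refl) auto
  also have "\<dots> = 1 / 6 * (row_product n x y - entry_product n x y)"
    unfolding sum_index_triples_symmetrized sum_distinct_triples ..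
  finally show ?thesis
    unfolding U3_def real_choose_three by (simp add: divide_simps)
qed

section \<open>Centred distance matrices\<close>

definition centred :: "nat \<Rightarrow> real \<Rightarrow> real \<Rightarrow> (nat \<Rightarrow> real) \<Rightarrow> nat \<Rightarrow> nat \<Rightarrow> real" where
  "centred n s t z i j = \<bar>z i - z j\<bar> - s * (row_sum n z i + row_sum n z j) + t"

lemma centred_commute: "centred n s t z i j = centred n s t z j i"
  by (simp add: centred_def abs_minus_commute add.commute)

text \<open>
  By symmetry of the matrices, each quadratic term of the expansion collapses: the products \<open>a\<^sub>i\<^sub>j b\<^sub>i\<^sub>\<cdot>\<close> and \<open>a\<^sub>i\<^sub>j b\<^sub>j\<^sub>\<cdot>\<close> sum to
  \<open>R\<close>, the products \<open>a\<^sub>i\<^sub>\<cdot> b\<^sub>i\<^sub>\<cdot>\<close> to \<open>n R\<close>, and the mixed products \<open>a\<^sub>i\<^sub>\<cdot> b\<^sub>j\<^sub>\<cdot>\<close> to \<open>S T\<close>.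
\<close>
lemma sum_centred_product:
  "(\<Sum>i = 1..n. \<Sum>j = 1..n. centred n s t x i j * centred n s u y i j) =
     entry_product n x y + (2 * real n * s\<^sup>2 - 4 * s) * row_product n x y
     + 2 * s\<^sup>2 * (total n x * total n y)
     + (1 - 2 * real n * s) * (u * total n x + t * total n y) + (real n)\<^sup>2 * t * u"
proof -
  let ?I = "{1..n}"
  let ?a = "\<lambda>i j. \<bar>x i - x j\<bar>" and ?b = "\<lambda>i j. \<bar>y i - y j\<bar>"
  let ?r = "row_sum n x" and ?q = "row_sum n y"
  have col: "(\<Sum>i\<in>?I. \<bar>z i - z j\<bar>) = row_sum n z j" for z j
    by (simp add: row_sum_def abs_minus_commute)
  have ar: "(\<Sum>i\<in>?I. \<Sum>j\<in>?I. ?a i j * ?q i) = row_product n x y"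
       "(\<Sum>i\<in>?I. \<Sum>j\<in>?I. ?r i * ?b i j) = row_product n x y"
    by (simp_all only: sum_distrib_left[symmetric] sum_distrib_right[symmetric]
        row_sum_def[symmetric] row_product_def)
  have ac: "(\<Sum>i\<in>?I. \<Sum>j\<in>?I. ?a i j * ?q j) = row_product n x y"
       "(\<Sum>i\<in>?I. \<Sum>j\<in>?I. ?r j * ?b i j) = row_product n x y"
    by (subst sum.swap, simp only: sum_distrib_left[symmetric] sum_distrib_right[symmetric]
        col row_product_def)+
  have rq: "(\<Sum>i\<in>?I. \<Sum>j\<in>?I. ?r i * ?q i) = real n * row_product n x y"
       "(\<Sum>i\<in>?I. \<Sum>j\<in>?I. ?r j * ?q j) = real n * row_product n x y"
    by (simp_all add: row_product_def sum_distrib_left)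
  have tt: "(\<Sum>i\<in>?I. \<Sum>j\<in>?I. ?r i * ?q j) = total n x * total n y"
    unfolding total_def by (rule sum_product[symmetric])
  then have tt': "(\<Sum>i\<in>?I. \<Sum>j\<in>?I. ?r j * ?q i) = total n x * total n y"
    by (subst sum.swap)
  have one: "(\<Sum>i\<in>?I. \<Sum>j\<in>?I. \<bar>z i - z j\<bar>) = total n z"
       "(\<Sum>i\<in>?I. \<Sum>j\<in>?I. row_sum n z i) = real n * total n z"
       "(\<Sum>i\<in>?I. \<Sum>j\<in>?I. row_sum n z j) = real n * total n z" for z
    by (simp_all add: total_def row_sum_def flip: sum_distrib_left)
  have const: "(\<Sum>i\<in>?I. \<Sum>j\<in>?I. c) = real n * (real n * c)" for c :: real
    by simp
  have "(\<Sum>i\<in>?I. \<Sum>j\<in>?I. centred n s t x i j * centred n s u y i j) =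
    (\<Sum>i\<in>?I. \<Sum>j\<in>?I. ?a i j * ?b i j
      - s * (?a i j * ?q i) - s * (?a i j * ?q j)
      - s * (?r i * ?b i j) - s * (?r j * ?b i j)
      + s\<^sup>2 * (?r i * ?q i) + s\<^sup>2 * (?r j * ?q j) + s\<^sup>2 * (?r i * ?q j) + s\<^sup>2 * (?r j * ?q i)
      + u * ?a i j + t * ?b i j
      - s * u * ?r i - s * u * ?r j - s * t * ?q i - s * t * ?q j + t * u)"
    by (intro sum.cong refl) (simp add: centred_def algebra_simps power2_eq_square)
  also have "\<dots> = (\<Sum>i\<in>?I. \<Sum>j\<in>?I. ?a i j * ?b i j)
      - s * (\<Sum>i\<in>?I. \<Sum>j\<in>?I. ?a i j * ?q i) - s * (\<Sum>i\<in>?I. \<Sum>j\<in>?I. ?a i j * ?q j)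
      - s * (\<Sum>i\<in>?I. \<Sum>j\<in>?I. ?r i * ?b i j) - s * (\<Sum>i\<in>?I. \<Sum>j\<in>?I. ?r j * ?b i j)
      + s\<^sup>2 * (\<Sum>i\<in>?I. \<Sum>j\<in>?I. ?r i * ?q i) + s\<^sup>2 * (\<Sum>i\<in>?I. \<Sum>j\<in>?I. ?r j * ?q j)
      + s\<^sup>2 * (\<Sum>i\<in>?I. \<Sum>j\<in>?I. ?r i * ?q j) + s\<^sup>2 * (\<Sum>i\<in>?I. \<Sum>j\<in>?I. ?r j * ?q i)
      + u * (\<Sum>i\<in>?I. \<Sum>j\<in>?I. ?a i j) + t * (\<Sum>i\<in>?I. \<Sum>j\<in>?I. ?b i j)
      - s * u * (\<Sum>i\<in>?I. \<Sum>j\<in>?I. ?r i) - s * u * (\<Sum>i\<in>?I. \<Sum>j\<in>?I. ?r j)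
      - s * t * (\<Sum>i\<in>?I. \<Sum>j\<in>?I. ?q i) - s * t * (\<Sum>i\<in>?I. \<Sum>j\<in>?I. ?q j)
      + (\<Sum>i\<in>?I. \<Sum>j\<in>?I. t * u)"
    by (simp only: sum.distrib sum_subtractf sum_distrib_left)
  also have "\<dots> = entry_product n x y - 4 * (s * row_product n x y)
      + 2 * (s\<^sup>2 * (real n * row_product n x y)) + 2 * (s\<^sup>2 * (total n x * total n y))
      + u * total n x + t * total n y
      - 2 * (s * u * (real n * total n x)) - 2 * (s * t * (real n * total n y))
      + real n * (real n * (t * u))"
    by (simp only: ar ac rq tt tt' one const entry_product_def[symmetric])
  finally show ?thesis
    by (simp add: algebra_simps power2_eq_square)
qed

lemma sum_centred_diagonal:
  "(\<Sum>i = 1..n. centred n s t x i i * centred n s u y i i) =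
     4 * s\<^sup>2 * row_product n x y - 2 * s * (u * total n x + t * total n y) + real n * t * u"
proof -
  have "(\<Sum>i = 1..n. centred n s t x i i * centred n s u y i i) =
    (\<Sum>i = 1..n. 4 * s\<^sup>2 * (row_sum n x i * row_sum n y i)
      - 2 * s * u * row_sum n x i - 2 * s * t * row_sum n y i + t * u)"
    by (intro sum.cong refl) (simp add: centred_def algebra_simps power2_eq_square)
  also have "\<dots> = 4 * s\<^sup>2 * row_product n x y - 2 * s * u * total n x - 2 * s * t * total n y
      + real n * (t * u)"
    by (simp add: sum.distrib sum_subtractf row_product_def total_def flip: sum_distrib_left)
  finally show ?thesis
    by (simp add: algebra_simps)
qed

lemma B_mean_eq: "B_mean n z = total n z / (real n)\<^sup>2"
  by (simp add: B_mean_def A_mean_def total_def row_sum_def power2_eq_square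
      flip: sum_divide_distrib)

lemma h_hat_eq_centred:
  "h_hat n z i j = - (1 / 2) * centred n (1 / real n) (total n z / (real n)\<^sup>2) z i j"
  unfolding h_hat_def B_mean_eq centred_def A_mean_def row_sum_def
  by (simp add: algebra_simps)

lemma h_tilde_eq_centred:
  assumes "n \<noteq> 0"
  shows "h_tilde n z i j =
    - (1 / 2) * centred n (1 / (real n - 1)) (total n z / (real n * (real n - 1))) z i j"
proof -
  have A: "real n / (real n - 1) * A_mean n z i = 1 / (real n - 1) * row_sum n z i" for i
    using assms by (simp add: A_mean_def row_sum_def)
  have B: "real n / (real n - 1) * B_mean n z = total n z / (real n * (real n - 1))"
    using assms by (simp add: B_mean_eq power2_eq_square)
  show ?thesis
    unfolding h_tilde_def A B centred_def by (simp add: algebra_simps)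
qed

section \<open>The two estimators in terms of the U-statistics\<close>

text \<open>
  For \<open>s = 1 / n\<close> the coefficient of \<open>R\<close> in the expansion is \<open>2 / n - 4 / n = - 2 / n\<close>, and \<open>S T\<close>
  receives \<open>2 / n\<^sup>2 - 2 / n\<^sup>2 + 1 / n\<^sup>2\<close>.
\<close>
lemma kappa_hat_eq:
  assumes "n \<noteq> 0"
  shows "kappa_hat n x y = 1 / 4 *
    (entry_product n x y / real n ^ 2 - 2 * row_product n x y / real n ^ 3
     + total n x * total n y / real n ^ 4)"
proof -
  let ?c = "\<lambda>z. centred n (1 / real n) (total n z / (real n)\<^sup>2) z"
  have "(\<Sum>i = 1..n. \<Sum>j = 1..n. h_hat n x i j * h_hat n y i j) =
        1 / 4 * (\<Sum>i = 1..n. \<Sum>j = 1..n. ?c x i j * ?c y i j)"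
    unfolding sum_distrib_left h_hat_eq_centred by (intro sum.cong refl) simp
  then have eq: "kappa_hat n x y =
      1 / (real n)\<^sup>2 * (1 / 4 * (\<Sum>i = 1..n. \<Sum>j = 1..n. ?c x i j * ?c y i j))"
    unfolding kappa_hat_def by (simp only:)
  show ?thesis
    unfolding eq sum_centred_product using assms
    by (simp add: divide_simps) algebra
qed

text \<open>
  With \<open>s = 1 / (n - 1)\<close>, removing the diagonal lowers the coefficient of \<open>R\<close> from
  \<open>2 n s\<^sup>2 - 4 s\<close> to \<open>(2 n - 4) s\<^sup>2 - 4 s = - 2 n / (n - 1)\<^sup>2\<close>.
\<close>
lemma kappa_tilde_eq:
  assumes "n \<ge> 2"
  shows "kappa_tilde n x y = 1 / 4 / (real n * (real n - 1)) *
    (entry_product n x y - 2 * real n / (real n - 1)\<^sup>2 * row_product n x y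
     + (real n + 1) / (real n * (real n - 1)\<^sup>2) * (total n x * total n y))"
proof -
  let ?c = "\<lambda>z. centred n (1 / (real n - 1)) (total n z / (real n * (real n - 1))) z"
  have n: "n \<noteq> 0" "real n \<noteq> 0" "real n - 1 \<noteq> 0"
    using assms by auto
  have "kappa_tilde n x y =
        inverse (real (n choose 2)) * (\<Sum>(i, j) \<in> index_pairs n. 1 / 4 * (?c x i j * ?c y i j))"
    unfolding kappa_tilde_def h_tilde_eq_centred[OF n(1)] by simp
  also have "\<dots> = ((\<Sum>i = 1..n. \<Sum>j = 1..n. 1 / 4 * (?c x i j * ?c y i j))
      - (\<Sum>i = 1..n. 1 / 4 * (?c x i i * ?c y i i))) / (real n * (real n - 1))"
    by (rule pair_average) (simp add: centred_commute)
  also have "\<dots> = 1 / 4 * ((\<Sum>i = 1..n. \<Sum>j = 1..n. ?c x i j * ?c y i j)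
      - (\<Sum>i = 1..n. ?c x i i * ?c y i i)) / (real n * (real n - 1))"
    by (simp only: sum_distrib_left[symmetric] right_diff_distrib)
  finally have eq: "kappa_tilde n x y = \<dots>" .
  \<comment> \<open>In \<open>m\<close> the denominators are products of \<open>m\<close> and \<open>m + 1\<close>, so clearing them leaves a
     polynomial identity.\<close>
  define m where "m = real n - 1"
  have m: "real n = m + 1" "m \<noteq> 0" "m + 1 \<noteq> 0"
    using n by (simp_all add: m_def)
  show ?thesis
    unfolding eq sum_centred_product sum_centred_diagonal m(1) using m(2,3)
    by (simp add: divide_simps) algebra
qed

theorem lemma6:
  fixes n :: nat and x y :: "nat \<Rightarrow> real"
  assumes "n \<ge> 3"
  shows "kappa_tilde n x y =
           kappa_star n x y + 1 / 4 *
             (- 2 * real n / (real n - 1)\<^sup>2 * U12 n x y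
              + 2 / (real n - 1)\<^sup>2 * U3 n x y
              + 2 / (real n - 1) * (U_dist n x * U_dist n y))
       \<and> kappa_hat n x y =
           kappa_star n x y + 1 / 4 *
             ((2 - 3 * real n) / (real n)\<^sup>2 * U12 n x y
              - 2 * ((2 - 3 * real n) / (real n)\<^sup>2) * U3 n x y
              + (1 - 2 * real n) / (real n)\<^sup>2 * (U_dist n x * U_dist n y))"
proof -
  let ?N = "real n"
  let ?P = "U12 n x y" and ?U = "U3 n x y" and ?D = "U_dist n x * U_dist n y"
  have n: "?N \<noteq> 0" "?N - 1 \<noteq> 0" "?N - 2 \<noteq> 0"
    using assms by auto
  \<comment> \<open>Solving the formulas for the U-statistics for the full sums.\<close>
  have P: "entry_product n x y = ?N * (?N - 1) * ?P"
    using n by (simp add: U12_eq)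
  have R: "row_product n x y = ?N * (?N - 1) * ((?N - 2) * ?U + ?P)"
    using n by (simp add: U12_eq U3_eq distrib_left)
  have ST: "total n x * total n y = (?N * (?N - 1))\<^sup>2 * ?D"
    using n by (simp add: U_dist_eq power2_eq_square)
  have tilde: "kappa_tilde n x y = 1 / 4 *
      ((1 - 2 * ?N / (?N - 1)\<^sup>2) * ?P - 2 * ?N * (?N - 2) / (?N - 1)\<^sup>2 * ?U
        + (?N + 1) / (?N - 1) * ?D)"
  proof -
    have "kappa_tilde n x y = 1 / 4 / (?N * (?N - 1)) *
      (?N * (?N - 1) * ?P - 2 * ?N / (?N - 1)\<^sup>2 * (?N * (?N - 1) * ((?N - 2) * ?U + ?P))
       + (?N + 1) / (?N * (?N - 1)\<^sup>2) * ((?N * (?N - 1))\<^sup>2 * ?D))"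
      using kappa_tilde_eq[of n x y] assms unfolding P R ST by simp
    also have "\<dots> = 1 / 4 *
      ((1 - 2 * ?N / (?N - 1)\<^sup>2) * ?P - 2 * ?N * (?N - 2) / (?N - 1)\<^sup>2 * ?U
        + (?N + 1) / (?N - 1) * ?D)"
      using n by (simp add: divide_simps) (simp add: algebra_simps power2_eq_square)
    finally show ?thesis .
  qed
  have hat: "kappa_hat n x y = 1 / 4 * ((?N - 1) * (?N - 2) / ?N\<^sup>2 * (?P - 2 * ?U)
      + (?N - 1)\<^sup>2 / ?N\<^sup>2 * ?D)"
  proof -
    have "kappa_hat n x y = 1 / 4 * (?N * (?N - 1) * ?P / ?N ^ 2
        - 2 * (?N * (?N - 1) * ((?N - 2) * ?U + ?P)) / ?N ^ 3
        + (?N * (?N - 1))\<^sup>2 * ?D / ?N ^ 4)"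
      using kappa_hat_eq[of n x y] assms unfolding P R ST by simp
    also have "\<dots> = 1 / 4 * ((?N - 1) * (?N - 2) / ?N\<^sup>2 * (?P - 2 * ?U)
        + (?N - 1)\<^sup>2 / ?N\<^sup>2 * ?D)"
      using n by (simp add: divide_simps) (simp add: algebra_simps eval_nat_numeral)
    finally show ?thesis .
  qed
  \<comment> \<open>In \<open>kappa_star\<close> the coefficients of \<open>U12\<close>, \<open>U3\<close> and \<open>U_dist n x * U_dist n y\<close> inside the
     bracket are \<open>1\<close>, \<open>- 2\<close> and \<open>1\<close>; splitting off these limits as \<open>n \<rightarrow> \<infinity>\<close> leaves the correction.\<close>
  have coeffs: "?N * (?N - 2) / (?N - 1)\<^sup>2 = 1 - 1 / (?N - 1)\<^sup>2"
    "(?N + 1) / (?N - 1) = 1 + 2 / (?N - 1)"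
    "(?N - 1) * (?N - 2) / ?N\<^sup>2 = 1 + (2 - 3 * ?N) / ?N\<^sup>2"
    "(?N - 1)\<^sup>2 / ?N\<^sup>2 = 1 + (1 - 2 * ?N) / ?N\<^sup>2"
    using n by (simp_all add: divide_simps) (simp_all add: algebra_simps power2_eq_square)
  show ?thesis
  proof
    show "kappa_tilde n x y = kappa_star n x y + 1 / 4 *
        (- 2 * ?N / (?N - 1)\<^sup>2 * ?P + 2 / (?N - 1)\<^sup>2 * ?U + 2 / (?N - 1) * ?D)"
      using tilde coeffs(1,2) unfolding kappa_star_def by algebra
    show "kappa_hat n x y = kappa_star n x y + 1 / 4 *
        ((2 - 3 * ?N) / ?N\<^sup>2 * ?P - 2 * ((2 - 3 * ?N) / ?N\<^sup>2) * ?U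
          + (1 - 2 * ?N) / ?N\<^sup>2 * ?D)"
      using hat unfolding coeffs(3,4) kappa_star_def by algebra
  qed
qed

end
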